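(* Let $\mathcal S$ be a semigroup, regarded as a semigroupoid with $\mathcal S^{(2)}=\mathcal S\times\mathcal S$, and let $(\alpha,X)$ be a partial semigroupoid action of $\mathcal S$ on a set $X$. Then the tensor product globalization $(\gamma,\mathcal S^1\otimes X)$ and the universal globalization $(\beta,E)$ of $(\alpha,X)$ are isomorphic in the category $\mathcal A(\mathcal S)$ of global actions of $\mathcal S$ if and only if $(\alpha,X)$ is a non-degenerate partial action.
   Context: A semigroup is a non-empty set with an associative binary operation. For a semigroup $\mathcal S$ regarded as a semigroupoid, put $\mathcal S^s=\{t:(s,t)\in\mathcal S^{(2)}\}=\mathcal S$ for every $s$. A partial (semigroupoid) action of $\mathcal S$ on $X$ is a pair $\alpha=(\{{_sX}\}_{s\in \mathcal S},\{\alpha_s\}_{s\in \mathcal S})$ of subsets ${_sX}\subseteq X$ and functions $\alpha_s\colon {_sX}\to X$, with $X_s:=\alpha_s({_sX})$, such that for all $s,t$: (P1) $\alpha_t^{-1}({_sX}\cap X_t)={_tX}\cap{_{st}X}$; (P2) $\alpha_s(\alpha_t(x))=\alpha_{st}(x)$ for all $x\in{_tX}\cap{_{st}X}$. It is a global action if moreover (G1) $\mathcal S^s=\mathcal S^t\neq\emptyset$ implies ${_sX}={_tX}$, and (G2) ${_tX}={_{st}X}$ for all $(s,t)\in\mathcal S^{(2)}$. (So for a semigroup a global action has all ${_sX}$ equal, but not necessarily equal to $X$.) It is non-degenerate if $X=\bigcup_{s\in \mathcal S}({_sX}\cup X_s)$. A morphism of partial actions $\varphi\colon(\alpha,X)\to(\beta,Y)$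 is a function $\varphi\colon X\to Y$ with $\varphi({_sX})\subseteq{_sY}$ and $\varphi(\alpha_s(x))=\beta_s(\varphi(x))$ for all $s$ and $x\in{_sX}$. $\mathcal A(\mathcal S)$ is the category of global actions of $\mathcal S$ with these morphisms; isomorphisms are morphisms with a two-sided inverse morphism. Tensor product globalization. Let $\mathcal S^1=\mathcal S\cup\{1\}$ be the monoid obtained by adjoining a new identity element $1\notin\mathcal S$, and put ${_1X}=X$, $\alpha_1=\mathrm{id}_X$. Let $\approx$ be the equivalence relation on $\mathcal S^1\times X$ generated by $(s,x)\sim(t,y)$ whenever there is $u\in\mathcal S^1$ with $s=tu$, $x\in{_uX}$ and $\alpha_u(x)=y$. Let $\mathcal S^1\otimes X=(\mathcal S^1\times X)/{\approx}$, with classes denoted $t\otimes x$, and let $\gamma_s\colon\mathcal S^1\otimes X\to\mathcal S^1\otimes X$, $\gamma_s(t\otimes x)=st\otimes x$ for $s\in\mathcal S$. This is a global action of $\mathcal S$ (with every domain equal to $\mathcal S^1\otimes X$). Universal globalization. Put ${_\rho X}=\bigcup_{s\in\mathcal S}({_sX}\cup X_s)$. Let $\delta\notin\mathcal S$ be a symbol and $D=(\mathcal S\times{_\rho X})\cup(\{\delta\}\times X)$. Let $\approx$ be the smallest equivalence relation on $D$ such that (1) $(\delta,y)\approx(s,x)$ whenever $s\in\mathcal S$, $x\in{_sX}$ and $\alpha_s(x)=y$; (2) $(s,x)\approx(t,y)$ whenever $s,t\in\mathcal S$ and there is $u\in\mathcal S$ with $s=tu$, $x\in{_uX}$, $\alpha_u(x)=y$.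 Let $E=D/{\approx}$, classes denoted $[a,x]$. For each $s\in\mathcal S$, ${_sE}$ is the set of classes of elements of $\{(a,x)\in D:(a,x)\approx(t,y)\text{ for some }(t,y)\in D,\ t\in\mathcal S\}\cup\{(\delta,x):x\in{_\rho X}\}$, and $\beta_s\colon{_sE}\to E$ is given by $\beta_s([t,y])=[st,y]$ for $t\in\mathcal S$ and $\beta_s([\delta,x])=[s,x]$ for $x\in{_\rho X}$ (well defined). $(\beta,E)$ is a global action of $\mathcal S$, and together with $\iota\colon X\to E$, $\iota(x)=[\delta,x]$, it has the universal property that each morphism from $(\alpha,X)$ to a global action factors uniquely through $\iota$. *)

theory Defs
  imports "HOL-Library.FuncSet"
begin

section \<open>Partial and global actions of a semigroup\<close>

text \<open>
  A semigroup is a type of class \<^class>\<open>semigroup_mult\<close> (HOL types are non-empty). The set acted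
  on is a set, not a type, so it may be empty. The maps \<open>act A s\<close> are total HOL functions;
  only their values on \<open>dm A s\<close> are meaningful.
\<close>

record ('s, 'x) action =
  pts :: "'x set"
  dm :: "'s \<Rightarrow> 'x set"
  act :: "'s \<Rightarrow> 'x \<Rightarrow> 'x"

definition rng :: "('s, 'x) action \<Rightarrow> 's \<Rightarrow> 'x set" where
  "rng A s = act A s ` dm A s"

definition composable :: "('s::semigroup_mult \<times> 's) set" where
  "composable = UNIV \<times> UNIV"

definition succs :: "'s::semigroup_mult \<Rightarrow> 's set" where
  "succs s = {t. (s, t) \<in> composable}"

definition partial_action :: "('s::semigroup_mult, 'x) action \<Rightarrow> bool" where
  "partial_action A \<longleftrightarrow>
     (\<forall>s. dm A s \<subseteq> pts A) \<and>
     (\<forall>s. act A s \<in> dm A s \<rightarrow> pts A) \<and>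
     (\<forall>(s, t) \<in> composable.
        {x \<in> dm A t. act A t x \<in> dm A s \<inter> rng A t} = dm A t \<inter> dm A (s * t)) \<and>
     (\<forall>(s, t) \<in> composable. \<forall>x \<in> dm A t \<inter> dm A (s * t).
        act A s (act A t x) = act A (s * t) x)"

definition global_action :: "('s::semigroup_mult, 'x) action \<Rightarrow> bool" where
  "global_action A \<longleftrightarrow>
     partial_action A \<and>
     (\<forall>s t. succs s = succs t \<and> succs s \<noteq> {} \<longrightarrow> dm A s = dm A t) \<and>
     (\<forall>(s, t) \<in> composable. dm A t = dm A (s * t))"

definition rho :: "('s, 'x) action \<Rightarrow> 'x set" where
  "rho A = (\<Union>s. dm A s \<union> rng A s)"

definition nondegenerate :: "('s, 'x) action \<Rightarrow> bool" where
  "nondegenerate A \<longleftrightarrow> pts A = rho A"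

definition morphism ::
    "('s, 'x) action \<Rightarrow> ('s, 'y) action \<Rightarrow> ('x \<Rightarrow> 'y) \<Rightarrow> bool" where
  "morphism A B f \<longleftrightarrow>
     f \<in> pts A \<rightarrow> pts B \<and>
     (\<forall>s. f ` dm A s \<subseteq> dm B s) \<and>
     (\<forall>s. \<forall>x \<in> dm A s. f (act A s x) = act B s (f x))"

text \<open>
  Isomorphism in the category of global actions. Morphisms are functions on the underlying sets,
  so the two composites are required to be the identity on these sets only.
\<close>

definition isomorphic_global ::
    "('s::semigroup_mult, 'x) action \<Rightarrow> ('s, 'y) action \<Rightarrow> bool" where
  "isomorphic_global A B \<longleftrightarrow>
     global_action A \<and> global_action B \<and>
     (\<exists>f g. morphism A B f \<and> morphism B A g \<and>
        (\<forall>x \<in> pts A. g (f x) = x) \<and> (\<forall>y \<in> pts B. f (g y) = y))"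

section \<open>Generated equivalence relations\<close>

text \<open>
  The smallest equivalence relation on \<open>D\<close> containing \<open>G\<close>; meaningful for
  \<open>G \<subseteq> D \<times> D\<close>.
\<close>

definition generated_equiv :: "'a set \<Rightarrow> 'a rel \<Rightarrow> 'a rel" where
  "generated_equiv D G = \<Inter>{R. equiv D R \<and> G \<subseteq> R}"

lemma generated_equiv_least:
  "equiv D R \<Longrightarrow> G \<subseteq> R \<Longrightarrow> generated_equiv D G \<subseteq> R"
  by (auto simp: generated_equiv_def)

lemma generated_equiv_upper: "G \<subseteq> generated_equiv D G"
  by (auto simp: generated_equiv_def)

lemma equiv_generated_equiv:
  assumes "G \<subseteq> D \<times> D"
  shows "equiv D (generated_equiv D G)"
proof -
  have full: "equiv D (D \<times> D)"
    by (auto simp: equiv_def refl_on_def sym_def trans_def)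
  have sub: "generated_equiv D G \<subseteq> D \<times> D"
    using generated_equiv_least[OF full assms] .
  show ?thesis
  proof (rule equivI)
    show "generated_equiv D G \<subseteq> D \<times> D" by (rule sub)
    show "refl_on D (generated_equiv D G)"
      unfolding generated_equiv_def by (auto simp: refl_on_def equiv_def)
    show "sym (generated_equiv D G)"
      unfolding generated_equiv_def by (auto simp: sym_def equiv_def)
    show "trans (generated_equiv D G)"
      unfolding generated_equiv_def trans_def equiv_def by blast
  qed
qed

section \<open>The tensor product globalization\<close>

text \<open>A new identity is adjoined even if the semigroup already has one.\<close>

datatype 's adj1 = One | Elem 's

instantiation adj1 :: (semigroup_mult) monoid_mult
begin

definition one_adj1 :: "'a adj1" where "1 = One"

fun times_adj1 :: "'a adj1 \<Rightarrow> 'a adj1 \<Rightarrow> 'a adj1" where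
  "times_adj1 One b = b"
| "times_adj1 (Elem s) One = Elem s"
| "times_adj1 (Elem s) (Elem t) = Elem (s * t)"

instance
proof
  fix a b c :: "'a adj1"
  show "a * b * c = a * (b * c)"
    by (cases a; cases b; cases c) (simp_all add: mult.assoc)
  show "1 * a = a" by (simp add: one_adj1_def)
  show "a * 1 = a" by (cases a) (simp_all add: one_adj1_def)
qed

end

fun dm1 :: "('s, 'x) action \<Rightarrow> 's adj1 \<Rightarrow> 'x set" where
  "dm1 A One = pts A"
| "dm1 A (Elem s) = dm A s"

fun act1 :: "('s, 'x) action \<Rightarrow> 's adj1 \<Rightarrow> 'x \<Rightarrow> 'x" where
  "act1 A One = (\<lambda>x. x)"
| "act1 A (Elem s) = act A s"

definition tensor_carrier :: "('s, 'x) action \<Rightarrow> ('s adj1 \<times> 'x) set" where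
  "tensor_carrier A = UNIV \<times> pts A"

definition tensor_gen :: "('s::semigroup_mult, 'x) action \<Rightarrow> ('s adj1 \<times> 'x) rel" where
  "tensor_gen A = {((s, x), (t, y)) | s x t y. \<exists>u. s = t * u \<and> x \<in> dm1 A u \<and> act1 A u x = y}"

definition tensor_rel :: "('s::semigroup_mult, 'x) action \<Rightarrow> ('s adj1 \<times> 'x) rel" where
  "tensor_rel A = generated_equiv (tensor_carrier A) (tensor_gen A)"

definition tensor_class ::
    "('s::semigroup_mult, 'x) action \<Rightarrow> 's adj1 \<Rightarrow> 'x \<Rightarrow> ('s adj1 \<times> 'x) set" where
  "tensor_class A t x = tensor_rel A `` {(t, x)}"

text \<open>
  The maps on classes below are given by \<^const>\<open>the_elem\<close> of the set of all values
  obtained from representatives; well-definedness is proved in \<open>act_tensor\<close> and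
  \<open>act_universal\<close>.
\<close>

definition tensor_globalization ::
    "('s::semigroup_mult, 'x) action \<Rightarrow> ('s, ('s adj1 \<times> 'x) set) action" where
  "tensor_globalization A =
     \<lparr> pts = tensor_carrier A // tensor_rel A,
       dm = (\<lambda>s. tensor_carrier A // tensor_rel A),
       act = (\<lambda>s c. the_elem ((\<lambda>(t, x). tensor_class A (Elem s * t) x) ` c)) \<rparr>"

section \<open>The universal globalization\<close>

text \<open>\<open>None\<close> plays the role of the symbol \<open>\<delta>\<close>.\<close>

definition univ_carrier :: "('s, 'x) action \<Rightarrow> ('s option \<times> 'x) set" where
  "univ_carrier A = range Some \<times> rho A \<union> {None} \<times> pts A"

definition univ_gen :: "('s::semigroup_mult, 'x) action \<Rightarrow> ('s option \<times> 'x) rel" where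
  "univ_gen A =
     {((None, y), (Some s, x)) | s x y. x \<in> dm A s \<and> act A s x = y} \<union>
     {((Some s, x), (Some t, y)) | s x t y. \<exists>u. s = t * u \<and> x \<in> dm A u \<and> act A u x = y}"

definition univ_rel :: "('s::semigroup_mult, 'x) action \<Rightarrow> ('s option \<times> 'x) rel" where
  "univ_rel A = generated_equiv (univ_carrier A) (univ_gen A)"

definition univ_class ::
    "('s::semigroup_mult, 'x) action \<Rightarrow> 's option \<Rightarrow> 'x \<Rightarrow> ('s option \<times> 'x) set" where
  "univ_class A a x = univ_rel A `` {(a, x)}"

definition univ_dom :: "('s::semigroup_mult, 'x) action \<Rightarrow> ('s option \<times> 'x) set" where
  "univ_dom A =
     {p \<in> univ_carrier A. \<exists>t y. (Some t, y) \<in> univ_carrier A \<and> (p, (Some t, y)) \<in> univ_rel A} \<union>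
     {None} \<times> rho A"

fun univ_step :: "'s::semigroup_mult \<Rightarrow> 's option \<Rightarrow> 's" where
  "univ_step s (Some t) = s * t"
| "univ_step s None = s"

definition universal_globalization ::
    "('s::semigroup_mult, 'x) action \<Rightarrow> ('s, ('s option \<times> 'x) set) action" where
  "universal_globalization A =
     \<lparr> pts = univ_carrier A // univ_rel A,
       dm = (\<lambda>s. {univ_class A a x | a x. (a, x) \<in> univ_dom A}),
       act = (\<lambda>s c. the_elem ((\<lambda>(a, x). univ_class A (Some (univ_step s a)) x) ` c)) \<rparr>"

section \<open>Well-definedness\<close>

lemma tensor_gen_sub: "partial_action A \<Longrightarrow> tensor_gen A \<subseteq> tensor_carrier A \<times> tensor_carrier A"
proof -
  assume A: "partial_action A"
  have "x \<in> pts A \<and> act1 A u x \<in> pts A" if "x \<in> dm1 A u" for u x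
    using A that by (cases u) (auto simp: partial_action_def)
  then show ?thesis by (auto simp: tensor_gen_def tensor_carrier_def)
qed

lemma equiv_tensor_rel: "partial_action A \<Longrightarrow> equiv (tensor_carrier A) (tensor_rel A)"
  unfolding tensor_rel_def by (intro equiv_generated_equiv tensor_gen_sub)

lemma univ_gen_sub: "partial_action A \<Longrightarrow> univ_gen A \<subseteq> univ_carrier A \<times> univ_carrier A"
  unfolding univ_gen_def univ_carrier_def partial_action_def rho_def rng_def by fast

lemma equiv_univ_rel: "partial_action A \<Longrightarrow> equiv (univ_carrier A) (univ_rel A)"
  unfolding univ_rel_def by (intro equiv_generated_equiv univ_gen_sub)

lemma the_elem_image_class:
  assumes "equiv D R" "p \<in> D" "\<And>q. (p, q) \<in> R \<Longrightarrow> f q = f p"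
  shows "the_elem (f ` (R `` {p})) = f p"
proof -
  have "(p, p) \<in> R" using assms(1,2) by (auto simp: equiv_def refl_on_def)
  then have "R `` {p} \<noteq> {}" by blast
  then show ?thesis by (rule the_elem_image_unique) (use assms(3) in blast)
qed

lemma act_tensor:
  assumes A: "partial_action A" and x: "x \<in> pts A"
  shows "act (tensor_globalization A) s (tensor_class A t x) = tensor_class A (Elem s * t) x"
proof -
  let ?D = "tensor_carrier A" and ?R = "tensor_rel A"
  let ?f = "\<lambda>(t, x). (Elem s * t, x)"
  let ?Q = "{(p, q) \<in> ?D \<times> ?D. (?f p, ?f q) \<in> ?R}"
  note E = equiv_tensor_rel[OF A]
  have cl: "?f p \<in> ?D" if "p \<in> ?D" for p using that by (auto simp: tensor_carrier_def)
  have "equiv ?D ?Q"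
  proof (rule equivI)
    show "refl_on ?D ?Q" using E cl by (auto simp: refl_on_def equiv_def)
    show "sym ?Q" using E by (auto simp: sym_def equiv_def)
    show "trans ?Q" using E unfolding trans_def equiv_def by blast
  qed auto
  moreover have "tensor_gen A \<subseteq> ?Q"
  proof
    fix p assume p: "p \<in> tensor_gen A"
    then obtain t u x where "p = ((t * u, x), (t, act1 A u x))" "x \<in> dm1 A u"
      by (auto simp: tensor_gen_def)
    moreover from this have "((Elem s * t * u, x), (Elem s * t, act1 A u x)) \<in> tensor_gen A"
      by (auto simp: tensor_gen_def)
    then have "((Elem s * t * u, x), (Elem s * t, act1 A u x)) \<in> ?R"
      unfolding tensor_rel_def using generated_equiv_upper by blast
    moreover have "p \<in> ?D \<times> ?D" using p tensor_gen_sub[OF A] by blast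
    ultimately show "p \<in> ?Q" by (auto simp: mult.assoc)
  qed
  ultimately have "?R \<subseteq> ?Q" unfolding tensor_rel_def by (intro generated_equiv_least)
  then have "tensor_class A (Elem s * t') x' = tensor_class A (Elem s * t) x"
    if "((t, x), (t', x')) \<in> ?R" for t' x'
  proof -
    have "((Elem s * t, x), (Elem s * t', x')) \<in> ?R"
      using subsetD[OF \<open>?R \<subseteq> ?Q\<close> that] by simp
    then show ?thesis
      unfolding tensor_class_def by (rule equiv_class_eq[OF E, symmetric])
  qed
  moreover have "(t, x) \<in> ?D" using x by (simp add: tensor_carrier_def)
  ultimately have "the_elem ((\<lambda>(t, x). tensor_class A (Elem s * t) x) ` (?R `` {(t, x)})) =
      (\<lambda>(t, x). tensor_class A (Elem s * t) x) (t, x)"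
    by (intro the_elem_image_class[OF E]) (simp_all add: split_beta)
  then show ?thesis
    unfolding tensor_globalization_def tensor_class_def[of A t x] action.simps prod.case .
qed

lemma act_universal:
  assumes A: "partial_action A" and x: "x \<in> rho A"
  shows "act (universal_globalization A) s (univ_class A a x) =
    univ_class A (Some (univ_step s a)) x"
proof -
  let ?D = "univ_carrier A" and ?R = "univ_rel A"
  let ?f = "\<lambda>(a, x). (Some (univ_step s a), x)"
  let ?Q = "{(p, q) \<in> ?D \<times> ?D. p = q \<or> (?f p, ?f q) \<in> ?R}"
  note E = equiv_univ_rel[OF A]
  have "equiv ?D ?Q"
  proof (rule equivI)
    show "refl_on ?D ?Q" by (auto simp: refl_on_def)
    show "sym ?Q" using E by (auto simp: sym_def equiv_def)
    show "trans ?Q" using E unfolding trans_def equiv_def by blast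
  qed auto
  moreover have "univ_gen A \<subseteq> ?Q"
  proof
    fix p assume p: "p \<in> univ_gen A"
    then consider
        (delta) t x where "p = ((None, act A t x), (Some t, x))" "x \<in> dm A t"
      | (mult) t u x where "p = ((Some (t * u), x), (Some t, act A u x))" "x \<in> dm A u"
      unfolding univ_gen_def by blast
    then have "(?f (fst p), ?f (snd p)) \<in> ?R"
    proof cases
      case delta
      then have "((Some (s * t), x), (Some s, act A t x)) \<in> univ_gen A"
        by (auto simp: univ_gen_def)
      then have "((Some (s * t), x), (Some s, act A t x)) \<in> ?R"
        unfolding univ_rel_def using generated_equiv_upper by blast
      then show ?thesis using delta E by (auto simp: equiv_def sym_def)
    next
      case mult
      then have "((Some (s * t * u), x), (Some (s * t), act A u x)) \<in> univ_gen A"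
        by (auto simp: univ_gen_def)
      then have "((Some (s * t * u), x), (Some (s * t), act A u x)) \<in> ?R"
        unfolding univ_rel_def using generated_equiv_upper by blast
      then show ?thesis using mult by (simp add: mult.assoc)
    qed
    moreover have "p \<in> ?D \<times> ?D" using p univ_gen_sub[OF A] by blast
    ultimately show "p \<in> ?Q" by (auto simp: split_beta)
  qed
  ultimately have "?R \<subseteq> ?Q" unfolding univ_rel_def by (intro generated_equiv_least)
  then have "univ_class A (Some (univ_step s b)) y = univ_class A (Some (univ_step s a)) x"
    if "((a, x), (b, y)) \<in> ?R" for b y
  proof -
    have "(a, x) = (b, y) \<or> ((Some (univ_step s a), x), (Some (univ_step s b), y)) \<in> ?R"
      using subsetD[OF \<open>?R \<subseteq> ?Q\<close> that] by simp
    then show ?thesis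
      unfolding univ_class_def by (elim disjE) (simp, rule equiv_class_eq[OF E, symmetric])
  qed
  moreover have "(a, x) \<in> ?D"
  proof (cases a)
    case None
    have "rho A \<subseteq> pts A" using A by (auto simp: rho_def rng_def partial_action_def)
    then show ?thesis using x None by (auto simp: univ_carrier_def)
  qed (use x in \<open>auto simp: univ_carrier_def\<close>)
  ultimately have "the_elem ((\<lambda>(a, x). univ_class A (Some (univ_step s a)) x) ` (?R `` {(a, x)})) =
      (\<lambda>(a, x). univ_class A (Some (univ_step s a)) x) (a, x)"
    by (intro the_elem_image_class[OF E]) (simp_all add: split_beta)
  then show ?thesis
    unfolding universal_globalization_def univ_class_def[of A a x] action.simps prod.case .
qed

end

(* In a non-degenerate action rho A = pts A, so the bijection One -> None, Elem s -> Some s identifies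
   the two carriers; it also identifies the generated relations, hence the two quotients.
   Conversely, all domains of the tensor product globalization are full, so an isomorphism makes
   all domains of the universal globalization full. But for x outside rho A the
   point (None, x) is related only to itself, so its class lies in no domain. *)

theory Submission
  imports Defs
begin

text \<open>Pulling an equivalence relation back along \<open>m\<close> gives an equivalence
  relation on \<open>D\<close>; minimality applies once it contains \<open>G\<close>. A generator
  may land anywhere in the generated relation, so its image may also be a reversed generator or a
  reflexive pair.\<close>

lemma generated_equiv_map:
  assumes G': "G' \<subseteq> D' \<times> D'" and G: "G \<subseteq> D \<times> D"
    and D: "\<And>p. p \<in> D \<Longrightarrow> m p \<in> D'"
    and gen: "\<And>p q. (p, q) \<in> G \<Longrightarrow> (m p, m q) \<in> generated_equiv D' G'"
    and pq: "(p, q) \<in> generated_equiv D G"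
  shows "(m p, m q) \<in> generated_equiv D' G'"
proof -
  let ?R = "generated_equiv D' G'"
  let ?Q = "{(p, q) \<in> D \<times> D. (m p, m q) \<in> ?R}"
  note E = equiv_generated_equiv[OF G']
  have "equiv D ?Q"
  proof (rule equivI)
    show "refl_on D ?Q" using E D by (auto simp: refl_on_def equiv_def)
    show "sym ?Q" using E by (auto simp: sym_def equiv_def)
    show "trans ?Q" using E unfolding trans_def equiv_def by blast
  qed auto
  moreover have "G \<subseteq> ?Q" using G gen by blast
  ultimately have "generated_equiv D G \<subseteq> ?Q" by (rule generated_equiv_least)
  then show ?thesis using pq by blast
qed

section \<open>Both globalizations as global actions with full domains\<close>

text \<open>With all domains full, both sides of (P1) are all of \<open>pts B\<close>, and (G1),
  (G2) are immediate, which leaves only closure and associativity to check on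
  representatives.\<close>

lemma global_action_total:
  fixes B :: "('s::semigroup_mult, 'y) action"
  assumes dm: "\<And>s. dm B s = pts B"
    and closed: "\<And>s x. x \<in> pts B \<Longrightarrow> act B s x \<in> pts B"
    and assoc: "\<And>s t x. x \<in> pts B \<Longrightarrow> act B s (act B t x) = act B (s * t) x"
  shows "global_action B"
  using assms by (auto simp: global_action_def partial_action_def rng_def composable_def)

lemma tensor_pts:
  "pts (tensor_globalization A) = {tensor_class A t x | t x. x \<in> pts A}"
  by (auto simp: tensor_globalization_def tensor_class_def quotient_def tensor_carrier_def)

lemma tensor_dm: "dm (tensor_globalization A) s = pts (tensor_globalization A)"
  by (simp add: tensor_globalization_def)

lemma global_action_tensor:
  assumes A: "partial_action A"
  shows "global_action (tensor_globalization A)"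
proof (rule global_action_total)
  have mult: "Elem s * (Elem t * r) = Elem (s * t) * r" for s t :: 'a and r
    by (simp flip: mult.assoc)
  fix s t c
  assume "c \<in> pts (tensor_globalization A)"
  then obtain r x where "c = tensor_class A r x" "x \<in> pts A"
    by (auto simp: tensor_pts)
  then show "act (tensor_globalization A) s c \<in> pts (tensor_globalization A)"
    and "act (tensor_globalization A) s (act (tensor_globalization A) t c) =
      act (tensor_globalization A) (s * t) c"
    by (auto simp: act_tensor[OF A] tensor_pts mult)
qed (rule tensor_dm)

lemma rho_subset: "partial_action A \<Longrightarrow> rho A \<subseteq> pts A"
  by (auto simp: rho_def rng_def partial_action_def)

text \<open>Nondegeneracy lets both pieces of \<open>univ_carrier\<close> range over the same
  points, so the carrier is a full product like \<open>tensor_carrier\<close>.\<close>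

lemma universal_pts:
  assumes "nondegenerate A"
  shows "pts (universal_globalization A) = {univ_class A a x | a x. x \<in> pts A}"
proof -
  have "univ_carrier A = UNIV \<times> pts A"
    using assms unfolding univ_carrier_def nondegenerate_def
    by (auto simp: image_iff)
  then show ?thesis
    by (auto simp: universal_globalization_def univ_class_def quotient_def)
qed

text \<open>Every pair of the carrier lies in \<open>univ_dom\<close>: one with \<open>None\<close>
  since its point is in \<open>rho A\<close>, one with \<open>Some t\<close> since it is related to
  itself.\<close>

lemma universal_dm:
  assumes A: "partial_action A" and nd: "nondegenerate A"
  shows "dm (universal_globalization A) s = pts (universal_globalization A)"
proof -
  have "(a, x) \<in> univ_dom A \<longleftrightarrow> x \<in> pts A" for a x
  proof (cases a)
    case None
    then show ?thesis using nd
      by (auto simp: univ_dom_def univ_carrier_def nondegenerate_def)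
  next
    case (Some t)
    have "((a, x), (Some t, x)) \<in> univ_rel A" if "x \<in> rho A"
      using equiv_univ_rel[OF A] that Some
      by (auto simp: equiv_def refl_on_def univ_carrier_def)
    with Some nd show ?thesis
      unfolding univ_dom_def univ_carrier_def nondegenerate_def by blast
  qed
  then show ?thesis
    unfolding universal_pts[OF nd] by (simp add: universal_globalization_def)
qed

lemma global_action_universal:
  assumes A: "partial_action A" and nd: "nondegenerate A"
  shows "global_action (universal_globalization A)"
proof (rule global_action_total)
  have mult: "s * univ_step t a = univ_step (s * t) a" for s t :: 'a and a
    by (cases a) (simp_all add: mult.assoc)
  fix s t c
  assume "c \<in> pts (universal_globalization A)"
  then obtain a x where "c = univ_class A a x" "x \<in> pts A"
    by (auto simp: universal_pts[OF nd])
  moreover from this nd have "x \<in> rho A" by (simp add: nondegenerate_def)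
  ultimately show "act (universal_globalization A) s c \<in> pts (universal_globalization A)"
    and "act (universal_globalization A) s (act (universal_globalization A) t c) =
      act (universal_globalization A) (s * t) c"
    by (auto simp: act_universal[OF A] universal_pts[OF nd] mult)
qed (rule universal_dm[OF A nd])

section \<open>The bijection of carriers and the two generated relations\<close>

fun to_option :: "'s adj1 \<Rightarrow> 's option" where
  "to_option One = None"
| "to_option (Elem s) = Some s"

fun of_option :: "'s option \<Rightarrow> 's adj1" where
  "of_option None = One"
| "of_option (Some s) = Elem s"

lemma of_option_to_option [simp]: "of_option (to_option t) = t"
  by (cases t) simp_all

lemma to_option_of_option [simp]: "to_option (of_option a) = a"
  by (cases a) simp_all

lemma to_option_Elem_mult: "to_option (Elem s * t) = Some (univ_step s (to_option t))"
  by (cases t) simp_all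

text \<open>A generator from \<open>(t * u, x)\<close> to \<open>(t, act1 A u x)\<close> becomes a
  reflexive pair if \<open>u = One\<close>, a reversed generator of type (1) if only
  \<open>t = One\<close>, and a generator of type (2) otherwise. Nondegeneracy keeps the images
  \<open>(Some s, x)\<close> inside \<open>univ_carrier\<close>.\<close>

lemma tensor_rel_imp_univ_rel:
  assumes A: "partial_action A" and nd: "nondegenerate A"
    and "(p, q) \<in> tensor_rel A"
  shows "(map_prod to_option id p, map_prod to_option id q) \<in> univ_rel A"
  unfolding univ_rel_def
proof (rule generated_equiv_map[OF univ_gen_sub[OF A] tensor_gen_sub[OF A]])
  show "(p, q) \<in> generated_equiv (tensor_carrier A) (tensor_gen A)"
    using assms(3) by (simp add: tensor_rel_def)
  show carrier: "map_prod to_option id p \<in> univ_carrier A" if "p \<in> tensor_carrier A" for p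
    using that nd
    by (cases "fst p")
      (auto simp: tensor_carrier_def univ_carrier_def nondegenerate_def)
  fix p q assume pq: "(p, q) \<in> tensor_gen A"
  note E = equiv_univ_rel[OF A]
  obtain t u x where p: "p = (t * u, x)" "q = (t, act1 A u x)" and x: "x \<in> dm1 A u"
    using pq by (auto simp: tensor_gen_def)
  have "(map_prod to_option id p, map_prod to_option id q) \<in> univ_rel A"
  proof (cases u)
    case One
    then have "t * u = t" by (simp flip: one_adj1_def)
    then have "p = q" using p One by simp
    moreover have "q \<in> tensor_carrier A" using pq tensor_gen_sub[OF A] by blast
    ultimately show ?thesis
      using E carrier by (auto simp: equiv_def refl_on_def)
  next
    case (Elem v)
    show ?thesis
    proof (cases t)
      case One
      \<comment> \<open>Type (1) generators start at \<delta>, whereas tensor generators end at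
        \<open>One\<close>; hence the swap.\<close>
      then have "(map_prod to_option id q, map_prod to_option id p) \<in> univ_gen A"
        using p x Elem by (auto simp: univ_gen_def)
      then have "(map_prod to_option id q, map_prod to_option id p) \<in> univ_rel A"
        unfolding univ_rel_def using generated_equiv_upper by blast
      then show ?thesis using E unfolding equiv_def sym_def by blast
    next
      case (Elem s)
      then have "(map_prod to_option id p, map_prod to_option id q) \<in> univ_gen A"
        using p x \<open>u = Elem v\<close> by (auto simp: univ_gen_def)
      then show ?thesis
        unfolding univ_rel_def using generated_equiv_upper by blast
    qed
  qed
  then show "(map_prod to_option id p, map_prod to_option id q)
      \<in> generated_equiv (univ_carrier A) (univ_gen A)"
    by (simp add: univ_rel_def)
qed

lemma univ_rel_imp_tensor_rel:
  assumes A: "partial_action A" and "(p, q) \<in> univ_rel A"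
  shows "(map_prod of_option id p, map_prod of_option id q) \<in> tensor_rel A"
  unfolding tensor_rel_def
proof (rule generated_equiv_map[OF tensor_gen_sub[OF A] univ_gen_sub[OF A]])
  show "(p, q) \<in> generated_equiv (univ_carrier A) (univ_gen A)"
    using assms(2) by (simp add: univ_rel_def)
  show "map_prod of_option id p \<in> tensor_carrier A" if "p \<in> univ_carrier A" for p
    using that rho_subset[OF A] by (auto simp: tensor_carrier_def univ_carrier_def)
  fix p q assume pq: "(p, q) \<in> univ_gen A"
  have E: "equiv (tensor_carrier A) (generated_equiv (tensor_carrier A) (tensor_gen A))"
    by (rule equiv_generated_equiv[OF tensor_gen_sub[OF A]])
  from pq consider
      (delta) t x where "p = (None, act A t x)" "q = (Some t, x)" "x \<in> dm A t"
    | (mult) t u x where "p = (Some (t * u), x)" "q = (Some t, act A u x)" "x \<in> dm A u"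
    unfolding univ_gen_def by blast
  then show "(map_prod of_option id p, map_prod of_option id q)
      \<in> generated_equiv (tensor_carrier A) (tensor_gen A)"
  proof cases
    case delta
    then have "(map_prod of_option id q, map_prod of_option id p) \<in> tensor_gen A"
      \<comment> \<open>The factorization used is \<open>Elem t = One * Elem t\<close>.\<close>
      by (auto simp: tensor_gen_def intro!: exI[of _ "Elem t"])
    then have "(map_prod of_option id q, map_prod of_option id p)
        \<in> generated_equiv (tensor_carrier A) (tensor_gen A)"
      using generated_equiv_upper by blast
    then show ?thesis using E unfolding equiv_def sym_def by blast
  next
    case mult
    then have "(map_prod of_option id p, map_prod of_option id q) \<in> tensor_gen A"
      by (auto simp: tensor_gen_def intro!: exI[of _ "Elem u"])
    then show ?thesis using generated_equiv_upper by blast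
  qed
qed

text \<open>Transfer of the relation in both directions makes the image a whole class, not just a
  subset of one.\<close>

lemma image_tensor_class:
  assumes A: "partial_action A" and nd: "nondegenerate A"
  shows "map_prod to_option id ` tensor_class A t x = univ_class A (to_option t) x"
proof (intro equalityI subsetI)
  fix p assume "p \<in> map_prod to_option id ` tensor_class A t x"
  then show "p \<in> univ_class A (to_option t) x"
    using tensor_rel_imp_univ_rel[OF A nd, of "(t, x)"]
    by (auto simp: tensor_class_def univ_class_def)
next
  fix p assume "p \<in> univ_class A (to_option t) x"
  then have "map_prod of_option id p \<in> tensor_class A t x"
    using univ_rel_imp_tensor_rel[OF A, of "(to_option t, x)" p]
    by (simp add: tensor_class_def univ_class_def)
  moreover have "p = map_prod to_option id (map_prod of_option id p)"
    by (cases p) simp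
  ultimately show "p \<in> map_prod to_option id ` tensor_class A t x"
    by blast
qed

lemma image_univ_class:
  assumes A: "partial_action A" and nd: "nondegenerate A"
  shows "map_prod of_option id ` univ_class A a x = tensor_class A (of_option a) x"
proof -
  have "univ_class A a x = map_prod to_option id ` tensor_class A (of_option a) x"
    by (simp add: image_tensor_class[OF A nd])
  then show ?thesis
    by (simp add: image_image map_prod.compositionality comp_def)
qed

section \<open>Nondegenerate actions: the isomorphism\<close>

lemma isomorphic_if_nondegenerate:
  assumes A: "partial_action A" and nd: "nondegenerate A"
  shows "isomorphic_global (tensor_globalization A) (universal_globalization A)"
proof -
  let ?T = "tensor_globalization A" and ?E = "universal_globalization A"
  \<comment> \<open>Classes are sets of pairs, so direct images define the maps of quotients without
    choosing representatives.\<close>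
  let ?f = "image (map_prod to_option id)" and ?g = "image (map_prod of_option id)"
  note f = image_tensor_class[OF A nd] and g = image_univ_class[OF A nd]
  have rho: "x \<in> rho A" if "x \<in> pts A" for x
    using nd that by (simp add: nondegenerate_def)
  have step: "of_option (Some (univ_step s a)) = Elem s * of_option a" for s :: 'a and a
    by (cases a) simp_all
  have "morphism ?T ?E ?f"
    unfolding morphism_def tensor_dm universal_dm[OF A nd]
  proof (intro conjI allI ballI)
    show "?f \<in> pts ?T \<rightarrow> pts ?E" "?f ` pts ?T \<subseteq> pts ?E"
      unfolding tensor_pts universal_pts[OF nd] using f by blast+
    fix s c assume "c \<in> pts ?T"
    then obtain t x where "c = tensor_class A t x" "x \<in> pts A"
      by (auto simp: tensor_pts)
    then show "?f (act ?T s c) = act ?E s (?f c)"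
      by (simp add: f act_tensor[OF A] act_universal[OF A] rho to_option_Elem_mult)
  qed
  moreover have "morphism ?E ?T ?g"
    unfolding morphism_def tensor_dm universal_dm[OF A nd]
  proof (intro conjI allI ballI)
    show "?g \<in> pts ?E \<rightarrow> pts ?T" "?g ` pts ?E \<subseteq> pts ?T"
      unfolding tensor_pts universal_pts[OF nd] using g by blast+
    fix s c assume "c \<in> pts ?E"
    then obtain a x where "c = univ_class A a x" "x \<in> pts A"
      by (auto simp: universal_pts[OF nd])
    then show "?g (act ?E s c) = act ?T s (?g c)"
      \<comment> \<open>Unfolding \<open>of_option\<close> on \<open>Some\<close> would destroy the
        left-hand side of \<open>step\<close>.\<close>
      by (simp add: g act_tensor[OF A] act_universal[OF A] rho step del: of_option.simps)
  qed
  moreover have "\<forall>c \<in> pts ?T. ?g (?f c) = c" "\<forall>c \<in> pts ?E. ?f (?g c) = c"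
    by (auto simp: tensor_pts universal_pts[OF nd] f g)
  ultimately show ?thesis
    unfolding isomorphic_global_def
    using global_action_tensor[OF A] global_action_universal[OF A nd] by blast
qed

section \<open>The converse: points outside \<open>rho A\<close>\<close>

text \<open>The partition of the carrier into the single point \<open>(None, x)\<close> and the rest
  respects all generators: a pair with \<open>None\<close> occurs in a generator only if its point
  lies in some \<open>rng A s\<close>.\<close>

lemma univ_rel_isolated:
  assumes A: "partial_action A" and x: "x \<notin> rho A" and r: "((None, x), q) \<in> univ_rel A"
  shows "q = (None, x)"
proof -
  let ?D = "univ_carrier A" and ?p = "(None, x)"
  let ?Q = "{(p, q) \<in> ?D \<times> ?D. p = ?p \<longleftrightarrow> q = ?p}"
  have "equiv ?D ?Q"
    by (rule equivI) (auto simp: refl_on_def sym_def trans_def)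
  moreover have "univ_gen A \<subseteq> ?Q"
  proof
    fix e assume e: "e \<in> univ_gen A"
    then have "fst e \<noteq> ?p \<and> snd e \<noteq> ?p"
      using x unfolding univ_gen_def rho_def rng_def by fastforce
    moreover have "e \<in> ?D \<times> ?D" using e univ_gen_sub[OF A] by blast
    ultimately show "e \<in> ?Q" by auto
  qed
  ultimately have "univ_rel A \<subseteq> ?Q" unfolding univ_rel_def by (rule generated_equiv_least)
  then show ?thesis using r by blast
qed

lemma nondegenerate_if_isomorphic:
  assumes A: "partial_action A"
    and iso: "isomorphic_global (tensor_globalization A) (universal_globalization A)"
  shows "nondegenerate A"
proof -
  let ?T = "tensor_globalization A" and ?E = "universal_globalization A"
  obtain f g where f: "morphism ?T ?E f" and g: "morphism ?E ?T g"
    and fg: "\<And>c. c \<in> pts ?E \<Longrightarrow> f (g c) = c"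
    using iso by (auto simp: isomorphic_global_def)
  \<comment> \<open>Passing through \<open>?T\<close>, where domains are full, and back by
    \<open>f\<close> shows that \<open>c = f (g c)\<close> lies in the domain.\<close>
  have full: "c \<in> dm ?E s" if c: "c \<in> pts ?E" for c s
  proof -
    have "g c \<in> dm ?T s" using g c by (auto simp: morphism_def tensor_dm)
    then have "f (g c) \<in> dm ?E s" using f unfolding morphism_def by blast
    then show ?thesis by (simp add: fg[OF c])
  qed
  have "x \<in> rho A" if x: "x \<in> pts A" for x
  proof (rule ccontr)
    assume nx: "x \<notin> rho A"
    note E = equiv_univ_rel[OF A]
    have D: "(None, x) \<in> univ_carrier A" using x by (simp add: univ_carrier_def)
    then have "univ_class A None x \<in> pts ?E"
      by (auto simp: universal_globalization_def univ_class_def quotient_def)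
    \<comment> \<open>Any semigroup element would do: \<open>dm ?E s\<close> does not depend on
      \<open>s\<close>.\<close>
    then have "univ_class A None x \<in> dm ?E undefined" by (rule full)
    then obtain a y where ay: "(a, y) \<in> univ_dom A" "univ_class A None x = univ_class A a y"
      by (auto simp: universal_globalization_def)
    then have "(a, y) \<in> univ_carrier A"
      using rho_subset[OF A] by (auto simp: univ_dom_def univ_carrier_def)
    then have "((None, x), (a, y)) \<in> univ_rel A"
      using ay(2) E D eq_equiv_class_iff[OF E D] by (simp add: univ_class_def)
    then have "(a, y) = (None, x)" by (rule univ_rel_isolated[OF A nx])
    \<comment> \<open>Membership of \<open>(None, x)\<close> in \<open>univ_dom\<close> requires
      \<open>x \<in> rho A\<close> or a related pair \<open>(Some t, y)\<close>; isolation excludes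
      the latter.\<close>
    then show False
      using ay(1) nx univ_rel_isolated[OF A nx] by (auto simp: univ_dom_def)
  qed
  then show ?thesis using rho_subset[OF A] by (auto simp: nondegenerate_def)
qed

theorem proposition4p4:
  fixes A :: "('s::semigroup_mult, 'x) action"
  assumes "partial_action A"
  shows "isomorphic_global (tensor_globalization A) (universal_globalization A) \<longleftrightarrow> nondegenerate A"
  using isomorphic_if_nondegenerate nondegenerate_if_isomorphic assms by blast

end
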